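(* Let $\Sigma$ be a finite alphabet, let $n\ge 1$, and let $X\subseteq\Sigma$ and $R\subseteq\Sigma$ be such that $X\cap R=\emptyset$ and $|R|<n$. Let $A'_n$ be the set of all words $w$ of length $n$ over $\Sigma$ such that $w$ contains all characters from $R$ and none of the characters from $X$. Then there exists a universal cycle for $A'_n$.
   Context: A universal cycle for a finite set $A'$ of words of length $n$ over a finite alphabet is a cyclic sequence $c_0c_1\cdots c_{L-1}$ of letters, with $L=|A'|$, such that every word of $A'$ occurs exactly once among the $L$ windows $c_ic_{i+1}\cdots c_{i+n-1}$, $0\le i<L$ (indices modulo $L$). (If $A'$ is empty, the empty sequence is a universal cycle.) *)

theory Defs
  imports Main
begin

text \<open>The window of length \<open>n\<close> of the cyclic sequence \<open>c\<close> starting at position \<open>i\<close>;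
  a window longer than \<open>c\<close> wraps around \<open>c\<close> several times.\<close>

definition cyclic_window :: "'a list \<Rightarrow> nat \<Rightarrow> nat \<Rightarrow> 'a list" where
  "cyclic_window c n i = map (\<lambda>j. c ! ((i + j) mod length c)) [0..<n]"

text \<open>Meant for finite sets \<open>A\<close> of words of length \<open>n\<close> over a finite alphabet \<open>\<Sigma>\<close>.\<close>

definition universal_cycle :: "'a set \<Rightarrow> nat \<Rightarrow> 'a list set \<Rightarrow> 'a list \<Rightarrow> bool" where
  "universal_cycle \<Sigma> n A c \<longleftrightarrow>
     set c \<subseteq> \<Sigma> \<and> length c = card A \<and>
     (\<forall>w\<in>A. \<exists>!i. i < length c \<and> cyclic_window c n i = w)"

definition restricted_words :: "'a set \<Rightarrow> 'a set \<Rightarrow> 'a set \<Rightarrow> nat \<Rightarrow> 'a list set" where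
  "restricted_words \<Sigma> X R n =
     {w. length w = n \<and> set w \<subseteq> \<Sigma> \<and> R \<subseteq> set w \<and> set w \<inter> X = {}}"

end

theory Submission
  imports Defs Graph_Theory.Euler
begin

text \<open>
  Consider the de Bruijn digraph of a set \<open>A\<close> of words: its arcs are the words of \<open>A\<close>, and the arc
  \<open>w\<close> leads from \<open>butlast w\<close> to \<open>tl w\<close>. Two words can occur in consecutive windows of a cyclic
  sequence exactly if their arcs are consecutive, so a closed Euler trail, read off by taking the
  first letter of each arc, is a universal cycle (\<open>cyclic_window_of_closed_walk\<close>). If \<open>A\<close> is closed
  under rotation, then rotation maps the arcs into a vertex bijectively onto the arcs out of it, so
  the digraph is balanced and only its connectedness is left to prove
  (\<open>universal_cycle_if_linked\<close>).

  The arcs of a word and of its rotation are consecutive, and the arcs of two words that differ only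
  in the last letter start at the same vertex. Any other position can be rotated to the end, so it is
  enough to join any two restricted words by changes of single letters that stay inside the set. Here
  \<open>card R < n\<close> is decisive: by the pigeonhole principle some position \<open>f\<close> of a word is not needed to
  cover \<open>R\<close>. It can be overwritten freely, hence it can serve as the temporary variable
  in an exchange of two letters (\<open>linked_swap\<close>), which yields all permutations of a
  word (\<open>linked_if_mset_eq\<close>). To reach a word with a different multiset of letters, a surplus
  letter is overwritten by a missing one (\<open>linked_restricted_words\<close>).
\<close>

section \<open>Universal cycles from the de Bruijn digraph\<close>

text \<open>The \<open>j\<close>-th letter of the word at position \<open>i\<close> moves to the front in \<open>j\<close> steps, since each
  step drops one letter at the front.\<close>

lemma cyclic_window_of_closed_walk:
  assumes len: "\<And>w. w \<in> set p \<Longrightarrow> length w = n"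
    and step: "\<And>k. k < length p \<Longrightarrow> tl (p ! k) = butlast (p ! (Suc k mod length p))"
    and i: "i < length p"
  shows "cyclic_window (map hd p) n i = p ! i"
proof (rule nth_equalityI)
  define L where "L = length p"
  have L: "L > 0" using i by (auto simp: L_def)
  have len': "length (p ! (k mod L)) = n" for k
    using L by (intro len) (simp add: L_def)
  have nth: "p ! ((i + j) mod L) ! m = p ! i ! (j + m)" if "j + m < n" for j m
    using that
  proof (induction j arbitrary: m)
    case 0
    then show ?case using i by (simp add: L_def)
  next
    case (Suc j)
    have "tl (p ! ((i + j) mod L)) = butlast (p ! (Suc (i + j) mod L))"
      using step[of "(i + j) mod L"] L by (simp add: L_def mod_Suc_eq)
    then have "tl (p ! ((i + j) mod L)) ! m = butlast (p ! (Suc (i + j) mod L)) ! m"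
      by simp
    then have "p ! ((i + j) mod L) ! Suc m = p ! (Suc (i + j) mod L) ! m"
      using Suc.prems len'[of "i + j"] len'[of "Suc (i + j)"] by (simp add: nth_tl nth_butlast)
    then show ?case using Suc.IH[of "Suc m"] Suc.prems by simp
  qed
  show "length (cyclic_window (map hd p) n i) = length (p ! i)"
    using i by (simp add: cyclic_window_def len)
  fix j assume "j < length (cyclic_window (map hd p) n i)"
  then have j: "j < n" by (simp add: cyclic_window_def)
  have "hd (p ! ((i + j) mod L)) = p ! ((i + j) mod L) ! 0"
    using j len'[of "i + j"] by (intro hd_conv_nth) auto
  also have "\<dots> = p ! i ! j" using nth[of j 0] j by simp
  finally show "cyclic_window (map hd p) n i ! j = p ! i ! j"
    using j L by (simp add: cyclic_window_def L_def)
qed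

lemma (in pre_digraph) cas_nth:
  assumes "cas u p v" "k < length p"
  shows "head G (p ! k) = (if Suc k < length p then tail G (p ! Suc k) else v)"
  using assms
proof (induction p arbitrary: u k)
  case (Cons e p)
  then show ?case by (cases k; cases p) auto
qed simp

definition de_bruijn_digraph :: "'a list set \<Rightarrow> ('a list, 'a list) pre_digraph" where
  "de_bruijn_digraph A = \<lparr>verts = butlast ` A, arcs = A, tail = butlast, head = tl\<rparr>"

text \<open>Both kinds of moves keep to one component of the de Bruijn digraph: the first passes to a
  consecutive arc, the second to an arc with the same tail.\<close>

definition window_moves :: "'a list set \<Rightarrow> ('a list \<times> 'a list) set" where
  "window_moves A = {(v, w). v \<in> A \<and> w \<in> A \<and> (w = rotate1 v \<or> butlast w = butlast v)}"

lemma butlast_rotate1: "w \<noteq> [] \<Longrightarrow> butlast (rotate1 w) = tl w"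
  by (cases w) auto


theorem universal_cycle_if_linked:
  assumes fin: "finite A" and sub: "\<And>w. w \<in> A \<Longrightarrow> length w = n \<and> set w \<subseteq> \<Sigma>" and n: "n \<ge> 1"
    and rot: "\<And>w. w \<in> A \<Longrightarrow> rotate1 w \<in> A"
    and linked: "\<And>v w. v \<in> A \<Longrightarrow> w \<in> A \<Longrightarrow> (v, w) \<in> (window_moves A)\<^sup>*"
  shows "\<exists>c. universal_cycle \<Sigma> n A c"
proof (cases "A = {}")
  case True
  then have "universal_cycle \<Sigma> n A []" by (simp add: universal_cycle_def)
  then show ?thesis ..
next
  case False
  define G where "G = de_bruijn_digraph A"
  have G[simp]: "verts G = butlast ` A" "arcs G = A" "tail G = butlast" "head G = tl"
    by (simp_all add: G_def de_bruijn_digraph_def)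
  have ne: "w \<noteq> []" if "w \<in> A" for w using sub[OF that] n by auto
  have tl_butlast: "tl w = butlast (rotate1 w)" if "w \<in> A" for w
    using ne[OF that] by (simp add: butlast_rotate1)
  have inj: "inj_on rotate1 A"
    using inj_rotate1 by (rule inj_on_subset) simp
  \<comment> \<open>On a finite set an injective map into the set is onto it.\<close>
  have surj: "rotate1 ` A = A" using inj fin rot by (intro endo_inj_surj) auto
  interpret fin_digraph G
    by standard (auto simp: fin tl_butlast rot)
  have deg: "in_degree G u = out_degree G u" for u
  proof -
    have "out_arcs G u = rotate1 ` in_arcs G u"
    proof
      show "out_arcs G u \<subseteq> rotate1 ` in_arcs G u"
      proof
        fix w assume w: "w \<in> out_arcs G u"
        then obtain v where "v \<in> A" "w = rotate1 v" using surj by auto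
        then show "w \<in> rotate1 ` in_arcs G u" using w tl_butlast by auto
      qed
    qed (auto simp: rot tl_butlast)
    moreover have "inj_on rotate1 (in_arcs G u)" using inj by (rule inj_on_subset) auto
    ultimately show ?thesis by (simp add: in_degree_def out_degree_def card_image)
  qed
  have reach: "butlast v \<rightarrow>\<^sup>*\<^bsub>G\<^esub> butlast w" if "v \<in> A" "(v, w) \<in> (window_moves A)\<^sup>*" for v w
    using that(2)
  proof induction
    case base
    show ?case using that(1) by (intro reachable_refl) simp
  next
    case (step x y)
    from step.hyps(2) consider "x \<in> A" "y = rotate1 x" | "butlast y = butlast x"
      by (auto simp: window_moves_def)
    then show ?case
    proof cases
      case 1
      then have "butlast x \<rightarrow>\<^bsub>G\<^esub> butlast y"
        using in_arcs_imp_in_arcs_ends[of x] by (simp add: arc_to_ends_def tl_butlast)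
      then show ?thesis by (rule reachable_adj_trans[OF step.IH])
    next
      case 2
      then show ?thesis using step.IH by simp
    qed
  qed
  have "connected G"
  proof (rule connectedI)
    show "verts G \<noteq> {}" using False by simp
    fix x y assume "x \<in> verts G" "y \<in> verts G"
    then have "x \<rightarrow>\<^sup>*\<^bsub>G\<^esub> y" using reach linked by auto
    then show "x \<rightarrow>\<^sup>*\<^bsub>mk_symmetric G\<^esub> y" by (rule reachable_mk_symmetricI)
  qed
  then obtain u p where "euler_trail u p u" using closed_euler1 deg by blast
  then have cas: "cas u p u" and dist: "distinct p" and set_p: "set p = A"
    by (auto simp: euler_trail_def trail_def awalk_def)
  have step: "tl (p ! k) = butlast (p ! (Suc k mod length p))" if k: "k < length p" for k
  proof (cases "Suc k < length p")
    case True
    then show ?thesis using cas_nth[OF cas k] by simp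
  next
    case last: False
    then have "Suc k = length p" using k by simp
    moreover have "u = butlast (p ! 0)" using cas k by (cases p) auto
    ultimately show ?thesis using cas_nth[OF cas k] by simp
  qed
  have window: "cyclic_window (map hd p) n i = p ! i" if "i < length p" for i
    using cyclic_window_of_closed_walk[of p n i] step sub set_p that by blast
  have "universal_cycle \<Sigma> n A (map hd p)"
    unfolding universal_cycle_def
  proof (intro conjI ballI)
    show "set (map hd p) \<subseteq> \<Sigma>" using set_p sub ne by force
    show "length (map hd p) = card A" using set_p dist distinct_card by fastforce
    fix w assume "w \<in> A"
    then obtain i where "i < length p" "p ! i = w" using set_p by (metis in_set_conv_nth)
    then show "\<exists>!i. i < length (map hd p) \<and> cyclic_window (map hd p) n i = w"
      using dist window by (intro ex1I[of _ i]) (auto simp: nth_eq_iff_index_eq)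
  qed
  then show ?thesis ..
qed

section \<open>Changing a letter at an arbitrary position\<close>

lemma linked_rotate:
  assumes rot: "\<And>w. w \<in> A \<Longrightarrow> rotate1 w \<in> A" and w: "w \<in> A"
  shows "rotate k w \<in> A \<and> (w, rotate k w) \<in> (window_moves A)\<^sup>*"
proof (induction k)
  case (Suc k)
  then have "(rotate k w, rotate (Suc k) w) \<in> window_moves A"
    by (auto simp: window_moves_def rot)
  with Suc show ?case by (auto simp: rot)
qed (simp add: w)

text \<open>The position is rotated to the end, changed, and rotated on around to its old place.\<close>

lemma linked_update:
  assumes rot: "\<And>w. w \<in> A \<Longrightarrow> rotate1 w \<in> A"
    and v: "v \<in> A" and w: "v[i := c] \<in> A" and i: "i < length v"
  shows "(v, v[i := c]) \<in> (window_moves A)\<^sup>*"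
proof -
  define xs ys where "xs = take i v" and "ys = drop (Suc i) v"
  have v_eq: "v = (xs @ [v ! i]) @ ys" and w_eq: "v[i := c] = (xs @ [c]) @ ys"
    using i by (simp_all add: xs_def ys_def id_take_nth_drop[symmetric] upd_conv_take_nth_drop)
  have to_end: "rotate (Suc (length xs)) ((xs @ [b]) @ ys) = ys @ xs @ [b]" for b
    using rotate_append[of "xs @ [b]" ys] by simp
  have "rotate (Suc (length xs)) v = ys @ xs @ [v ! i]" using to_end v_eq by metis
  then have 1: "ys @ xs @ [v ! i] \<in> A" "(v, ys @ xs @ [v ! i]) \<in> (window_moves A)\<^sup>*"
    using linked_rotate[OF rot v, of "Suc (length xs)"] by simp_all
  have "rotate (Suc (length xs)) (v[i := c]) = ys @ xs @ [c]" using to_end w_eq by metis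
  then have 2: "ys @ xs @ [c] \<in> A"
    using linked_rotate[OF rot w, of "Suc (length xs)"] by simp
  have "rotate (length ys) (ys @ xs @ [c]) = v[i := c]"
    using rotate_append[of ys "xs @ [c]"] w_eq by simp
  then have 3: "(ys @ xs @ [c], v[i := c]) \<in> (window_moves A)\<^sup>*"
    using linked_rotate[OF rot 2, of "length ys"] by simp
  have "(ys @ xs @ [v ! i], ys @ xs @ [c]) \<in> window_moves A"
    using 1 2 by (simp add: window_moves_def butlast_append)
  with 1 3 show ?thesis by (meson rtrancl.rtrancl_into_rtrancl rtrancl_trans)
qed

section \<open>Linking the restricted words\<close>

lemma rotate1_restricted_words:
  "w \<in> restricted_words \<Sigma> X R n \<Longrightarrow> rotate1 w \<in> restricted_words \<Sigma> X R n"
  by (simp add: restricted_words_def)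

lemma restricted_words_mset_cong:
  assumes "mset v = mset w" "v \<in> restricted_words \<Sigma> X R n"
  shows "w \<in> restricted_words \<Sigma> X R n"
  using assms mset_eq_setD[OF assms(1)] mset_eq_length[OF assms(1)]
  by (simp add: restricted_words_def)

lemma linked_restricted_update:
  assumes "v \<in> restricted_words \<Sigma> X R n" "v[i := c] \<in> restricted_words \<Sigma> X R n" "i < n"
  shows "(v, v[i := c]) \<in> (window_moves (restricted_words \<Sigma> X R n))\<^sup>*"
  using assms by (intro linked_update rotate1_restricted_words) (auto simp: restricted_words_def)

lemma free_position:
  assumes "finite R" "R \<subseteq> set w" "card R < length w"
  obtains f where "f < length w" "\<And>r. r \<in> R \<Longrightarrow> \<exists>k<length w. k \<noteq> f \<and> w ! k = r"
proof -
  have "\<forall>r\<in>R. \<exists>k. k < length w \<and> w ! k = r"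
    using assms(2) by (auto simp: subset_iff in_set_conv_nth)
  then obtain g where g: "\<And>r. r \<in> R \<Longrightarrow> g r < length w \<and> w ! g r = r"
    by metis
  have "card (g ` R) < card {..<length w}"
    using card_image_le[OF assms(1), of g] assms(3) by simp
  then have "\<not> {..<length w} \<subseteq> g ` R" using assms(1) by (meson card_mono finite_imageI leD)
  then obtain f where "f < length w" "f \<notin> g ` R" by auto
  then show ?thesis using g that by blast
qed

text \<open>A free position \<open>f\<close> is the temporary variable of the exchange. If \<open>f\<close> is itself one of the two
  positions, then it takes the other letter, and its old letter is written to the other position.\<close>

lemma linked_swap:
  assumes fin: "finite R" and card: "card R < n" and w: "w \<in> restricted_words \<Sigma> X R n"
    and pq: "p < n" "q < n"
  shows "(w, w[p := w ! q, q := w ! p]) \<in> (window_moves (restricted_words \<Sigma> X R n))\<^sup>*"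
proof -
  let ?W = "restricted_words \<Sigma> X R n" and ?M = "(window_moves (restricted_words \<Sigma> X R n))\<^sup>*"
  have len: "length w = n" and sub: "set w \<subseteq> \<Sigma> - X" and R: "R \<subseteq> set w"
    using w by (auto simp: restricted_words_def)
  obtain f where f: "f < n" and cover: "\<And>r. r \<in> R \<Longrightarrow> \<exists>k<n. k \<noteq> f \<and> w ! k = r"
    using free_position[OF fin R] card len by auto
  have letter: "w ! k \<in> \<Sigma> - X" if "k < n" for k using that len sub by (metis nth_mem subsetD)
  have W_I: "v \<in> ?W" if "length v = n" "\<And>k. k < n \<Longrightarrow> v ! k \<in> \<Sigma> - X"
    "\<And>k. k < n \<Longrightarrow> k \<noteq> f \<Longrightarrow> \<exists>j<n. v ! j = w ! k" for v
  proof -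
    have "R \<subseteq> set v"
    proof
      fix r assume "r \<in> R"
      then obtain k where "k < n" "k \<noteq> f" "w ! k = r" using cover by auto
      then show "r \<in> set v" using that(1,3) by (metis nth_mem)
    qed
    moreover have "set v \<subseteq> \<Sigma> - X" using that(1,2) by (auto simp: in_set_conv_nth)
    ultimately show ?thesis using that(1) by (auto simp: restricted_words_def)
  qed
  have upd: "(v, v[i := c]) \<in> ?M" if "v \<in> ?W" "v[i := c] \<in> ?W" "i < n" for v i c
    using that by (rule linked_restricted_update)
  have perm: "w[a := w ! b, b := w ! a] \<in> ?W" if "a < n" "b < n" for a b
    using mset_swap[of b w a] that len
    by (intro restricted_words_mset_cong[OF _ w]) simp
  have fill: "w[f := w ! a] \<in> ?W" if "a < n" for a
  proof (rule W_I)
    fix k assume "k < n" "k \<noteq> f"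
    then show "\<exists>j<n. w[f := w ! a] ! j = w ! k" by (intro exI[of _ k]) simp
  qed (use that letter len f in \<open>auto simp: nth_list_update\<close>)
  have with_f: "(w, w[f := w ! a, a := w ! f]) \<in> ?M" if "a < n" for a
    using upd[OF w fill[OF that] f] upd[OF fill[OF that] perm[OF f that] that]
    by (rule rtrancl_trans)
  consider "p = f" | "q = f" | "p = q" | "p \<noteq> f" "q \<noteq> f" "p \<noteq> q" by auto
  then show ?thesis
  proof cases
    case 1
    then show ?thesis using with_f[OF pq(2)] by simp
  next
    case 2
    then show ?thesis using with_f[OF pq(1)] list_update_swap[of p f w] by (cases "p = f") simp_all
  next
    case 3
    then show ?thesis by simp
  next
    case 4
    define v1 v2 v3 where "v1 = w[f := w ! p]" and "v2 = v1[p := w ! q]" and "v3 = v2[q := w ! p]"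
    have v1: "v1 \<in> ?W" using fill pq by (simp add: v1_def)
    have v2: "v2 \<in> ?W"
    proof (rule W_I)
      fix k assume k: "k < n" "k \<noteq> f"
      show "\<exists>j<n. v2 ! j = w ! k"
        using k f len 4 by (intro exI[of _ "if k = p then f else k"]) (auto simp: v2_def v1_def)
    qed (use letter len pq f in \<open>auto simp: v1_def v2_def nth_list_update\<close>)
    have v3: "v3 \<in> ?W"
    proof (rule W_I)
      fix k assume k: "k < n" "k \<noteq> f"
      show "\<exists>j<n. v3 ! j = w ! k"
        using k f len 4 pq
        by (intro exI[of _ "if k = p then q else if k = q then p else k"])
          (auto simp: v3_def v2_def v1_def nth_list_update)
    qed (use letter len pq f in \<open>auto simp: v1_def v2_def v3_def nth_list_update\<close>)
    have v4: "v3[f := w ! f] = w[p := w ! q, q := w ! p]"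
      using 4 len f pq by (intro nth_equalityI) (auto simp: v3_def v2_def v1_def nth_list_update)
    have "(w, v1) \<in> ?M" using upd[OF w _ f] v1 by (simp add: v1_def)
    moreover have "(v1, v2) \<in> ?M" using upd[OF v1 _ pq(1)] v2 by (simp add: v2_def)
    moreover have "(v2, v3) \<in> ?M" using upd[OF v2 _ pq(2)] v3 by (simp add: v3_def)
    moreover have "(v3, v3[f := w ! f]) \<in> ?M" using upd[OF v3 _ f, of "w ! f"] perm[OF pq] v4 by simp
    ultimately have "(w, v3[f := w ! f]) \<in> ?M" by (meson rtrancl_trans)
    then show ?thesis using v4 by simp
  qed
qed

text \<open>Selection sort: the letter that belongs at the front of the unsorted part \<open>xs\<close> is swapped to
  it, and the sorted prefix \<open>ps\<close> grows.\<close>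

lemma linked_if_mset_eq:
  assumes fin: "finite R" and card: "card R < n"
    and "ps @ xs \<in> restricted_words \<Sigma> X R n" and "mset xs = mset ys"
  shows "(ps @ xs, ps @ ys) \<in> (window_moves (restricted_words \<Sigma> X R n))\<^sup>*"
  using assms(3,4)
proof (induction ys arbitrary: ps xs)
  case (Cons y ys)
  let ?W = "restricted_words \<Sigma> X R n"
  have "y \<in> set xs" using mset_eq_setD[OF Cons.prems(2)] by simp
  then obtain q where q: "q < length xs" "xs ! q = y" by (metis in_set_conv_nth)
  define xs' where "xs' = xs[0 := xs ! q, q := xs ! 0]"
  have len: "length (ps @ xs) = n" using Cons.prems(1) by (simp add: restricted_words_def)
  have mset: "mset xs' = mset xs"
    using mset_swap[of q xs 0] q(1) by (cases xs) (simp_all add: xs'_def)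
  have "(ps @ xs)[length ps := (ps @ xs) ! (length ps + q), length ps + q := (ps @ xs) ! length ps]
      = ps @ xs'"
    using q(1) by (simp add: list_update_append nth_append xs'_def)
  then have swap: "(ps @ xs, ps @ xs') \<in> (window_moves ?W)\<^sup>*"
    using linked_swap[OF fin card Cons.prems(1), of "length ps" "length ps + q"] q len
    by (simp del: append_assoc)
  have "xs' ! 0 = y" using q by (cases xs) (auto simp: xs'_def split: nat.split)
  moreover have "xs' \<noteq> []" using q by (auto simp: xs'_def)
  ultimately obtain zs where xs': "xs' = y # zs" by (cases xs') auto
  have "ps @ xs' \<in> ?W"
    using mset by (intro restricted_words_mset_cong[OF _ Cons.prems(1)]) simp
  then have "(ps @ [y]) @ zs \<in> ?W" using xs' by simp
  moreover have "mset zs = mset ys"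
    using mset Cons.prems(2) xs' by simp
  ultimately have "((ps @ [y]) @ zs, (ps @ [y]) @ ys) \<in> (window_moves ?W)\<^sup>*"
    by (rule Cons.IH)
  then have "(ps @ xs', ps @ y # ys) \<in> (window_moves ?W)\<^sup>*" using xs' by simp
  with swap show ?case by (rule rtrancl_trans)
qed simp

text \<open>If the multisets of letters differ, some letter \<open>x\<close> occurs more often in \<open>v\<close> than in \<open>w\<close> and
  some \<open>y\<close> less often. As \<open>w\<close> covers \<open>R\<close>, an \<open>x\<close> in \<open>R\<close> occurs at least twice in \<open>v\<close>, so one of its
  occurrences may be overwritten by \<open>y\<close>, which reduces the surplus of \<open>v\<close> over \<open>w\<close>.\<close>

lemma linked_restricted_words:
  assumes fin: "finite R" and card: "card R < n"
    and "v \<in> restricted_words \<Sigma> X R n" and w: "w \<in> restricted_words \<Sigma> X R n"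
  shows "(v, w) \<in> (window_moves (restricted_words \<Sigma> X R n))\<^sup>*"
  using assms(3)
proof (induction "size (mset v - mset w)" arbitrary: v rule: less_induct)
  case less
  let ?W = "restricted_words \<Sigma> X R n"
  note v = less.prems
  have len: "length v = n" "length w = n" and sub: "set v \<subseteq> \<Sigma> - X" "set w \<subseteq> \<Sigma> - X"
    and R: "R \<subseteq> set v" "R \<subseteq> set w"
    using v w by (auto simp: restricted_words_def)
  show ?case
  proof (cases "mset v = mset w")
    case True
    then show ?thesis using linked_if_mset_eq[OF fin card, of "[]" v] v by simp
  next
    case False
    have size: "size (mset v) = size (mset w)" using len by simp
    then have "\<not> mset v \<subseteq># mset w" "\<not> mset w \<subseteq># mset v"
      using False by (metis mset_subset_size subset_mset.le_neq_trans less_irrefl)+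
    then obtain x y where x: "count (mset w) x < count (mset v) x"
      and y: "count (mset v) y < count (mset w) y"
      by (auto simp: subseteq_mset_def not_le)
    have "x \<in># mset v" using x by (metis count_eq_zero_iff not_less_zero)
    then obtain i where i: "i < n" "v ! i = x" using len by (auto simp: in_set_conv_nth)
    define v' where "v' = v[i := y]"
    have mset: "mset v' = add_mset y (mset v - {#x#})"
      using i len by (simp add: v'_def mset_update)
    have y_w: "y \<in> set w" using y by (metis count_mset_0_iff not_less_zero)
    have "R \<subseteq> set v'"
    proof
      fix r assume r: "r \<in> R"
      have "r \<in># mset v - {#x#}"
      proof (cases "r = x")
        case True
        have "1 \<le> count (mset w) x" using r R(2) True by (auto simp: count_greater_eq_one_iff)
        then have "1 < count (mset v) x" by (rule le_less_trans[OF _ x])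
        then show ?thesis using True by (simp add: in_diff_count)
      next
        case False
        then show ?thesis using r R(1) by (auto simp: in_diff_count)
      qed
      then have "r \<in># mset v'" using mset by simp
      then show "r \<in> set v'" by simp
    qed
    moreover have "set v' \<subseteq> \<Sigma> - X"
      using set_update_subset_insert[of v i y] sub y_w by (auto simp: v'_def)
    ultimately have v': "v' \<in> ?W" using len by (auto simp: restricted_words_def v'_def)
    have "x \<noteq> y" using x y by auto
    have "mset v - mset w = add_mset x (mset v' - mset w)"
      using x y \<open>x \<noteq> y\<close> by (intro multiset_eqI) (auto simp: mset)
    then have "size (mset v' - mset w) < size (mset v - mset w)" by simp
    then have "(v', w) \<in> (window_moves ?W)\<^sup>*" using v' by (rule less.hyps)
    moreover have "(v, v') \<in> (window_moves ?W)\<^sup>*"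
      using linked_restricted_update[OF v] v' i len by (simp add: v'_def)
    ultimately show ?thesis by simp
  qed
qed

theorem theorem11:
  fixes \<Sigma> X R :: "'a set" and n :: nat
  assumes "finite \<Sigma>"
    and "n \<ge> 1"
    and "X \<subseteq> \<Sigma>"
    and "R \<subseteq> \<Sigma>"
    and "X \<inter> R = {}"
    and "card R < n"
  shows "\<exists>c. universal_cycle \<Sigma> n (restricted_words \<Sigma> X R n) c"
proof (rule universal_cycle_if_linked)
  have "restricted_words \<Sigma> X R n \<subseteq> {w. set w \<subseteq> \<Sigma> \<and> length w = n}"
    by (auto simp: restricted_words_def)
  then show "finite (restricted_words \<Sigma> X R n)"
    using finite_lists_length_eq[OF assms(1)] by (rule finite_subset)
  fix v w assume "v \<in> restricted_words \<Sigma> X R n" "w \<in> restricted_words \<Sigma> X R n"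
  then show "(v, w) \<in> (window_moves (restricted_words \<Sigma> X R n))\<^sup>*"
    using linked_restricted_words assms finite_subset by metis
qed (use assms in \<open>auto simp: restricted_words_def\<close>)

end
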